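(* Assume that $K$ is a p.c.f. self-similar set. For $|f|\log^+|f|\in L^1(K,\mu)$, we have $$\int_K M_{\mathcal{D}}^\mu f(x)\, d\mu\le 2\mu(K)+8\int_K |f(x)|\log^+|f(x)|\, d\mu,$$ where $\log^+t:=\max\{0,\log t\}$ for any $t>0$.
   Context: Self-similar set and measure. For $1\le i\le m$ let $S_i:\mathbb{R}^d\to\mathbb{R}^d$, $S_i(x)=r_iR_i(x)+b_i$ with $0<r_i<1$, $b_i\in\mathbb{R}^d$, $R_i$ orthogonal. $K\subset\mathbb{R}^d$ is the unique nonempty compact set with $K=\bigcup_{i=1}^m S_i(K)$ (the self-similar set generated by $\{S_i\}_{i=1}^m$). It is always assumed that the $S_i$ do not all share a common fixed point. Given a probability vector $(p_1,\dots,p_m)$ with all $p_i>0$ and $\sum_i p_i=1$, $\mu$ is the unique Borel probability measure with $\mu=\sum_{i=1}^m p_i\,\mu\circ S_i^{-1}$ (self-similar measure; it is supported on $K$). Here $f$ is a $\mu$-measurable function on $K$, and $|f|\log^+|f|$ is $0$ where $f=0$. Basic cubes. $\Sigma_n=\{1,\dots,m\}^n$ for $n\ge1$. For $\mathbf{i}=i_1\ldots i_n$, $S_{\mathbf{i}}=S_{i_1}\circ\cdots\circ S_{i_n}$ and $K_{\mathbf{i}}=S_{\mathbf{i}}(K)$. $\mathcal{D}$ is the collection consisting of $K$ and all $K_{\mathbf{i}}$, $\mathbf{i}\in\Sigma_n$, $n\ge1$ (basic cubes). P.c.f. Let $\Sigma_\infty=\{1,\dots,m\}^{\mathbb{N}}$,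 let $\Pi:\Sigma_\infty\to K$ be the coding map, $\{\Pi(\mathbf{i})\}=\bigcap_{n\ge1}K_{i_1\ldots i_n}$, and let $\sigma$ be the shift $\sigma(i_1,i_2,\dots)=(i_2,i_3,\dots)$. Put $\mathcal{C}_K=\bigcup_{i\ne j}(S_i(K)\cap S_j(K))$ and $\mathcal{C}=\Pi^{-1}(\mathcal{C}_K)$. $K$ is post-critically finite (p.c.f.) if $\bigcup_{n\ge1}\sigma^n(\mathcal{C})$ is a finite set. Maximal operator. $M_{\mathcal{D}}^\mu f(x)=\sup\frac{1}{\mu(K_{\mathbf{i}})}\int_{K_{\mathbf{i}}}|f|\,d\mu$ for $x\in K$, the supremum being over all $n\in\mathbb{N}=\{1,2,\dots\}$ and all $\mathbf{i}\in\Sigma_n$ with $x\in K_{\mathbf{i}}$. *)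

theory Defs
  imports "HOL-Analysis.Analysis" "HOL-Probability.Probability_Measure"
begin

text \<open>Maps of the iterated function system are indexed by \<open>{1..m}\<close>; finite words are lists of
  indices, and infinite words are functions on \<open>nat\<close>, with \<open>i 0\<close> playing the role of
  the first letter.\<close>

definition self_similar_set :: "nat \<Rightarrow> (nat \<Rightarrow> 'a::euclidean_space \<Rightarrow> 'a) \<Rightarrow> 'a set \<Rightarrow> bool" where
  "self_similar_set m S K \<longleftrightarrow> K \<noteq> {} \<and> compact K \<and> K = (\<Union>i\<in>{1..m}. S i ` K)"

definition self_similar_measure ::
  "nat \<Rightarrow> (nat \<Rightarrow> 'a::euclidean_space \<Rightarrow> 'a) \<Rightarrow> (nat \<Rightarrow> real) \<Rightarrow> 'a measure \<Rightarrow> bool" where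
  "self_similar_measure m S p \<mu> \<longleftrightarrow>
     sets \<mu> = sets borel \<and> prob_space \<mu> \<and>
     (\<forall>A\<in>sets borel. emeasure \<mu> A = (\<Sum>i=1..m. ennreal (p i) * emeasure \<mu> (S i -` A)))"

definition words :: "nat \<Rightarrow> nat \<Rightarrow> nat list set" where
  "words m n = {w. length w = n \<and> set w \<subseteq> {1..m}}"

definition infinite_words :: "nat \<Rightarrow> (nat \<Rightarrow> nat) set" where
  "infinite_words m = {i. \<forall>k. i k \<in> {1..m}}"

definition word_map :: "(nat \<Rightarrow> 'a \<Rightarrow> 'a) \<Rightarrow> nat list \<Rightarrow> 'a \<Rightarrow> 'a" where
  "word_map S w = foldr (\<circ>) (map S w) id"

definition basic_cube :: "(nat \<Rightarrow> 'a \<Rightarrow> 'a) \<Rightarrow> 'a set \<Rightarrow> nat list \<Rightarrow> 'a set" where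
  "basic_cube S K w = word_map S w ` K"

definition coding_map :: "(nat \<Rightarrow> 'a \<Rightarrow> 'a) \<Rightarrow> 'a set \<Rightarrow> (nat \<Rightarrow> nat) \<Rightarrow> 'a" where
  "coding_map S K i = the_elem (\<Inter>n\<in>{1..}. basic_cube S K (map i [0..<n]))"

definition word_shift :: "(nat \<Rightarrow> nat) \<Rightarrow> nat \<Rightarrow> nat" where
  "word_shift i = (\<lambda>k. i (Suc k))"

definition overlap_set :: "nat \<Rightarrow> (nat \<Rightarrow> 'a \<Rightarrow> 'a) \<Rightarrow> 'a set \<Rightarrow> 'a set" where
  "overlap_set m S K = (\<Union>i\<in>{1..m}. \<Union>j\<in>{1..m} - {i}. S i ` K \<inter> S j ` K)"

definition critical_set :: "nat \<Rightarrow> (nat \<Rightarrow> 'a \<Rightarrow> 'a) \<Rightarrow> 'a set \<Rightarrow> (nat \<Rightarrow> nat) set" where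
  "critical_set m S K = {i \<in> infinite_words m. coding_map S K i \<in> overlap_set m S K}"

definition post_critically_finite :: "nat \<Rightarrow> (nat \<Rightarrow> 'a \<Rightarrow> 'a) \<Rightarrow> 'a set \<Rightarrow> bool" where
  "post_critically_finite m S K \<longleftrightarrow>
     finite (\<Union>n\<in>{1..}. (word_shift ^^ n) ` critical_set m S K)"

text \<open>Measurability with respect to \<open>\<mu>\<close> is understood in the sense of the completion of the
  Borel measure \<open>\<mu>\<close>, so integrals are taken against \<open>completion \<mu>\<close>.  The averages are
  extended nonnegative: no integrability of \<open>f\<close> is presupposed.\<close>

definition basic_cube_maximal ::
  "nat \<Rightarrow> (nat \<Rightarrow> 'a \<Rightarrow> 'a) \<Rightarrow> 'a set \<Rightarrow> 'a measure \<Rightarrow> ('a \<Rightarrow> real) \<Rightarrow> 'a \<Rightarrow> ennreal" where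
  "basic_cube_maximal m S K \<mu> f x =
     (SUP w \<in> {w \<in> (\<Union>n\<in>{1..}. words m n). x \<in> basic_cube S K w}.
        (\<integral>\<^sup>+y\<in>basic_cube S K w. ennreal \<bar>f y\<bar> \<partial>completion \<mu>) / emeasure \<mu> (basic_cube S K w))"

text \<open>At \<open>t = 0\<close> this evaluates to \<open>0\<close>, since \<open>ln 0 = 0\<close> in the library.\<close>

definition log_plus :: "real \<Rightarrow> real" where
  "log_plus t = max 0 (ln t)"

end

theory Submission
  imports Defs "HOL-Library.Sublist"
begin

text \<open>The basic cubes form a tree: \<open>K\<^sub>v\<close> contains \<open>K\<^sub>w\<close> whenever \<open>v\<close> is a prefix of \<open>w\<close>.  What makes
  the maximal operator as well behaved as a dyadic or martingale one is that cubes of incomparable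
  words overlap only in a \<open>\<mu>\<close>-null set, and this is where the geometry enters.  Post-critical
  finiteness makes the first-level overlap set finite, because every point of it has an address in
  the critical set and only finitely many words share a given shift; hence two cubes of
  incomparable words share finitely many points (\<open>finite_parallel_cubes_Int\<close>).  On the other hand
  \<open>\<mu>\<close> has no atoms: the atoms of maximal mass would form a finite set that every map of the
  system permutes, and a contraction can do that only on a single point, which would be a common
  fixed point (\<open>self_similar_measure_no_atoms\<close>).

  For such a tree the weak-type inequality holds with constant one: a superlevel set of the
  maximal function is the union of the cubes with large average, and the cubes of prefix-minimal
  words already cover it without essential overlap.  Cutting \<open>g = \<bar>f\<bar>\<close> off at height \<open>t / 2\<close>
  turns this into the estimate that \<open>t\<close> times the measure of \<open>{Mg > t}\<close> is at most twice the
  integral of \<open>g\<close> over \<open>{g > t / 2}\<close> (\<open>tree_maximal_function_weak_type\<close>).  Write the integral of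
  \<open>Mg\<close> as the integral over \<open>t > 0\<close> of the measures of the superlevel sets.  The part \<open>t \<le> 2\<close>
  contributes at most \<open>2 \<mu>(K)\<close>; in the part \<open>t > 2\<close>, exchanging the integrals leaves the inner
  integral of \<open>2 / t\<close> over \<open>2 < t < 2 g\<close>, which is \<open>2 log\<^sup>+ g\<close> (\<open>nn_integral_LlogL_bound\<close>).  This
  gives the inequality with \<open>2\<close> in the place of \<open>8\<close>.\<close>

section \<open>Cubes, addresses and finite overlaps\<close>

lemma word_map_simps [simp]:
  "word_map S [] = id"
  "word_map S (i # w) = S i \<circ> word_map S w"
  "word_map S (v @ w) = word_map S v \<circ> word_map S w"
proof -
  show "word_map S (v @ w) = word_map S v \<circ> word_map S w"
    unfolding word_map_def by (induction v) (simp_all add: comp_assoc)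
qed (simp_all add: word_map_def)

lemma basic_cube_append: "basic_cube S K (v @ w) = word_map S v ` basic_cube S K w"
  by (simp add: basic_cube_def image_comp)

text \<open>The orthogonal parts enter only through the similarity ratios, which give injectivity,
  continuity and contraction.\<close>

locale self_similar_system =
  fixes m :: nat and r :: "nat \<Rightarrow> real" and S :: "nat \<Rightarrow> 'a::euclidean_space \<Rightarrow> 'a" and K :: "'a set"
  assumes ratio: "\<And>i. i \<in> {1..m} \<Longrightarrow> 0 < r i \<and> r i < 1"
    and similarity: "\<And>i x y. i \<in> {1..m} \<Longrightarrow> dist (S i x) (S i y) = r i * dist x y"
    and attractor: "self_similar_set m S K"
begin

lemma inj_S: "i \<in> {1..m} \<Longrightarrow> inj (S i)"
  using ratio similarity by (intro injI) (metis dist_eq_0_iff mult_eq_0_iff less_irrefl)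

lemma continuous_S: "i \<in> {1..m} \<Longrightarrow> continuous_on A (S i)"
  using ratio[of i] similarity[of i]
  by (intro lipschitz_on_continuous_on[of "r i"] lipschitz_onI) auto

lemma inj_word_map: "set w \<subseteq> {1..m} \<Longrightarrow> inj (word_map S w)"
proof (induction w)
  case (Cons i w)
  then have "inj (S i)" "inj (word_map S w)" by (auto intro!: inj_S simp del: One_nat_def)
  then show ?case by (simp only: word_map_simps inj_compose)
qed simp

lemma continuous_word_map: "set w \<subseteq> {1..m} \<Longrightarrow> continuous_on A (word_map S w)"
proof (induction w)
  case (Cons i w)
  then have "continuous_on (word_map S w ` A) (S i)" "continuous_on A (word_map S w)"
    by (auto intro!: continuous_S simp del: One_nat_def)
  then show ?case by (simp add: continuous_on_compose del: comp_apply)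
qed (simp add: continuous_on_id)

lemma compact_basic_cube: "set w \<subseteq> {1..m} \<Longrightarrow> compact (basic_cube S K w)"
  unfolding basic_cube_def using attractor
  by (intro compact_continuous_image continuous_word_map) (auto simp: self_similar_set_def)

lemma K_eq: "K = (\<Union>i\<in>{1..m}. S i ` K)"
  using attractor by (simp add: self_similar_set_def)

lemma basic_cube_subset: "set w \<subseteq> {1..m} \<Longrightarrow> basic_cube S K w \<subseteq> K"
proof (induction w)
  case (Cons i w)
  then have "basic_cube S K (i # w) \<subseteq> S i ` K"
    by (auto simp: basic_cube_def)
  also have "\<dots> \<subseteq> K"
    using Cons.prems by (subst (2) K_eq) auto
  finally show ?case .
qed (simp add: basic_cube_def)

lemma basic_cube_prefix:
  assumes "prefix v w" "set w \<subseteq> {1..m}"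
  shows "basic_cube S K w \<subseteq> basic_cube S K v"
proof -
  obtain z where w: "w = v @ z" using assms by (auto elim: prefixE)
  then have "basic_cube S K z \<subseteq> K" using assms by (intro basic_cube_subset) auto
  then show ?thesis by (auto simp: w basic_cube_append) (auto simp: basic_cube_def)
qed

text \<open>Every point of \<open>K\<close> is the image of a point of \<open>K\<close> under some map; the address records the
  letters met when such preimages are chosen again and again.\<close>

lemma exists_address:
  assumes "x \<in> K"
  shows "\<exists>\<tau>\<in>infinite_words m. \<forall>n. x \<in> basic_cube S K (map \<tau> [0..<n])"
proof -
  have "\<forall>y\<in>K. \<exists>i z. i \<in> {1..m} \<and> z \<in> K \<and> y = S i z"
    using K_eq by blast
  then obtain L T where LT: "\<And>y. y \<in> K \<Longrightarrow> L y \<in> {1..m} \<and> T y \<in> K \<and> y = S (L y) (T y)"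
    by metis
  define \<tau> where "\<tau> k = L ((T ^^ k) x)" for k
  have orbit: "(T ^^ k) x \<in> K" for k
    by (induction k) (use assms LT in auto)
  have address: "word_map S (map \<tau> [0..<n]) ((T ^^ n) x) = x" for n
  proof (induction n)
    case (Suc n)
    have "S (\<tau> n) ((T ^^ Suc n) x) = (T ^^ n) x"
      using LT[OF orbit[of n]] by (simp add: \<tau>_def)
    with Suc show ?case by simp
  qed simp
  have "x \<in> basic_cube S K (map \<tau> [0..<n])" for n
    unfolding basic_cube_def by (rule image_eqI, rule address[symmetric], rule orbit)
  moreover have "\<tau> \<in> infinite_words m"
    using LT orbit by (simp add: infinite_words_def \<tau>_def)
  ultimately show ?thesis by blast
qed

text \<open>The nested cubes along an infinite word have diameters tending to zero geometrically, so a
  point that lies in all of them is the only one.  The largest ratio serves as the rate.\<close>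

lemma coding_map_eqI:
  assumes \<tau>: "\<tau> \<in> infinite_words m"
    and x: "\<And>n. x \<in> basic_cube S K (map \<tau> [0..<n])"
  shows "coding_map S K \<tau> = x"
proof -
  define \<rho> where "\<rho> = Max (insert 0 (r ` {1..m}))"
  have \<rho>: "0 \<le> \<rho>" "\<rho> < 1"
    unfolding \<rho>_def using ratio by (auto simp del: One_nat_def)
  have r_le: "r i \<le> \<rho>" if "i \<in> {1..m}" for i
    unfolding \<rho>_def using that by (intro Max_ge) auto
  have contraction: "dist (word_map S w a) (word_map S w b) \<le> \<rho> ^ length w * dist a b"
    if "set w \<subseteq> {1..m}" for w a b
    using that
  proof (induction w)
    case (Cons i w)
    have "dist (word_map S (i # w) a) (word_map S (i # w) b)
        = r i * dist (word_map S w a) (word_map S w b)"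
      using Cons.prems similarity by simp
    also have "\<dots> \<le> \<rho> * (\<rho> ^ length w * dist a b)"
      using Cons \<rho> r_le by (intro mult_mono) (auto simp del: One_nat_def)
    finally show ?case by (simp add: mult.assoc)
  qed simp
  have "bounded K" using attractor by (auto simp: self_similar_set_def compact_imp_bounded)
  then have diam: "dist a b \<le> diameter K" if "a \<in> K" "b \<in> K" for a b
    using that diameter_bounded_bound by blast
  have "y = x" if y: "\<And>n. 1 \<le> n \<Longrightarrow> y \<in> basic_cube S K (map \<tau> [0..<n])" for y
  proof -
    have "dist y x \<le> \<rho> ^ n * diameter K" if n: "1 \<le> n" for n
    proof -
      have letters: "set (map \<tau> [0..<n]) \<subseteq> {1..m}"
        using \<tau> by (auto simp: infinite_words_def)
      obtain a b where ab: "a \<in> K" "b \<in> K"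
        "y = word_map S (map \<tau> [0..<n]) a" "x = word_map S (map \<tau> [0..<n]) b"
        using y[OF n] x[of n] by (auto simp: basic_cube_def)
      then have "dist y x \<le> \<rho> ^ n * dist a b"
        using contraction[OF letters, of a b] by simp
      also have "\<dots> \<le> \<rho> ^ n * diameter K"
        using \<rho> ab diam by (intro mult_left_mono) auto
      finally show ?thesis .
    qed
    moreover have "(\<lambda>n. \<rho> ^ n * diameter K) \<longlonglongrightarrow> 0 * diameter K"
      using \<rho> by (intro tendsto_intros LIMSEQ_realpow_zero) auto
    ultimately have "dist y x \<le> 0 * diameter K"
      by (intro LIMSEQ_le_const) auto
    then show ?thesis by simp
  qed
  then have "(\<Inter>n\<in>{1..}. basic_cube S K (map \<tau> [0..<n])) = {x}"
    using x by auto
  then show ?thesis by (simp add: coding_map_def)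
qed

text \<open>The first shift of the critical set is finite by hypothesis, and a word is determined by its
  first letter and its shift, so the critical set is finite.  Since every point of \<open>K\<close> has an
  address, the overlap set is contained in the image of the critical set under the coding map.\<close>

lemma finite_overlap_set:
  assumes "post_critically_finite m S K"
  shows "finite (overlap_set m S K)"
proof -
  have "word_shift ` critical_set m S K \<subseteq> (\<Union>n\<in>{1..}. (word_shift ^^ n) ` critical_set m S K)"
    by (rule order.trans[OF _ UN_upper[of 1]]) auto
  with assms have fin: "finite (word_shift ` critical_set m S K)"
    unfolding post_critically_finite_def by (rule rev_finite_subset)
  have "critical_set m S K
      \<subseteq> (\<lambda>(i, \<tau>). case_nat i \<tau>) ` ({1..m} \<times> word_shift ` critical_set m S K)"
  proof
    fix \<tau> assume \<tau>: "\<tau> \<in> critical_set m S K"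
    have "\<tau> = (case (\<tau> 0, word_shift \<tau>) of (i, \<tau>') \<Rightarrow> case_nat i \<tau>')"
      by (rule ext) (simp add: word_shift_def split: nat.split)
    moreover have "(\<tau> 0, word_shift \<tau>) \<in> {1..m} \<times> word_shift ` critical_set m S K"
      using \<tau> by (simp add: critical_set_def infinite_words_def)
    ultimately show "\<tau> \<in> (\<lambda>(i, \<tau>). case_nat i \<tau>) ` ({1..m} \<times> word_shift ` critical_set m S K)"
      by (rule image_eqI)
  qed
  then have "finite (critical_set m S K)"
    by (rule finite_subset) (intro finite_imageI finite_cartesian_product fin finite_atLeastAtMost)
  moreover have "overlap_set m S K \<subseteq> coding_map S K ` critical_set m S K"
  proof
    fix x assume x: "x \<in> overlap_set m S K"
    then have "x \<in> (\<Union>i\<in>{1..m}. S i ` K)" by (auto simp: overlap_set_def)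
    then have "x \<in> K" by (simp add: K_eq[symmetric] del: One_nat_def UN_iff)
    then obtain \<tau> where \<tau>: "\<tau> \<in> infinite_words m" "\<And>n. x \<in> basic_cube S K (map \<tau> [0..<n])"
      using exists_address by blast
    then have "coding_map S K \<tau> = x" by (rule coding_map_eqI)
    then show "x \<in> coding_map S K ` critical_set m S K"
      using \<tau>(1) x by (auto simp: critical_set_def)
  qed
  ultimately show ?thesis by (rule rev_finite_subset[OF finite_imageI])
qed

text \<open>After their longest common prefix \<open>u\<close>, incomparable words continue with distinct letters, so
  their cubes meet inside the image of the overlap set under the map \<open>S\<^sub>u\<close>, which is injective.\<close>

lemma finite_parallel_cubes_Int:
  assumes "post_critically_finite m S K" "v \<parallel> w" "set v \<subseteq> {1..m}" "set w \<subseteq> {1..m}"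
  shows "finite (basic_cube S K v \<inter> basic_cube S K w)"
proof -
  obtain u i v' j w' where ij: "i \<noteq> j" and v: "v = u @ i # v'" and w: "w = u @ j # w'"
    using parallel_decomp[OF assms(2)] by (elim exE conjE) (rule that)
  have ij_range: "i \<in> {1..m}" "j \<in> {1..m}" and u: "set u \<subseteq> {1..m}"
    using assms(3,4) v w by auto
  have first_level: "basic_cube S K (u @ k # z) \<subseteq> word_map S u ` S k ` K"
    if "set (u @ k # z) \<subseteq> {1..m}" for k z
  proof -
    have "basic_cube S K (u @ k # z) \<subseteq> basic_cube S K (u @ [k])"
      using that by (intro basic_cube_prefix) auto
    then show ?thesis by (simp add: basic_cube_def image_comp comp_assoc)
  qed
  have "basic_cube S K v \<inter> basic_cube S K w \<subseteq> word_map S u ` S i ` K \<inter> word_map S u ` S j ` K"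
    using first_level[of i v'] first_level[of j w'] assms(3,4) unfolding v w
    by (intro Int_mono) auto
  also have "\<dots> = word_map S u ` (S i ` K \<inter> S j ` K)"
    using inj_word_map[OF u] by (rule image_Int[symmetric])
  also have "\<dots> \<subseteq> word_map S u ` overlap_set m S K"
    unfolding overlap_set_def using ij ij_range by (intro image_mono) blast
  finally show ?thesis
    by (rule finite_subset) (intro finite_imageI finite_overlap_set assms(1))
qed

section \<open>Self-similar measures have no atoms\<close>

text \<open>The largest distance \<open>D\<close> between points of \<open>A\<close> is attained at images of points of \<open>A\<close>, so
  \<open>D \<le> r\<^sub>i D\<close> and \<open>D = 0\<close>: the set is a single point, which all maps fix.\<close>

lemma backward_invariant_finite_set_fixed:
  assumes A: "finite A" "A \<noteq> {}" and backward: "\<And>i. i \<in> {1..m} \<Longrightarrow> A \<subseteq> S i ` A"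
  shows "\<exists>x. \<forall>i\<in>{1..m}. S i x = x"
proof -
  define D where "D = (\<lambda>(a, b). dist a b) ` (A \<times> A)"
  have D: "finite D" "D \<noteq> {}" unfolding D_def using A by simp_all
  obtain x where x: "x \<in> A" using A by blast
  have "S i x = x" if i: "i \<in> {1..m}" for i
  proof -
    have "Max D \<in> D" using D by simp
    then obtain a b where ab: "a \<in> A" "b \<in> A" "Max D = dist a b" by (auto simp: D_def)
    then obtain a' b' where ab': "a' \<in> A" "b' \<in> A" "a = S i a'" "b = S i b'"
      using backward[OF i] by blast
    have "dist a' b' \<le> Max D" using D ab' by (intro Max_ge) (auto simp: D_def)
    then have "Max D \<le> r i * Max D"
      using ab ab' similarity[OF i, of a' b'] ratio[OF i] by (metis mult_left_mono less_imp_le)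
    then have "(1 - r i) * Max D \<le> 0" by (simp add: algebra_simps)
    then have Max_le: "Max D \<le> 0" using ratio[OF i] by (simp add: mult_le_0_iff)
    obtain y where y: "y \<in> A" "x = S i y" using backward[OF i] x by blast
    have "dist x y \<le> Max D" using D x y by (intro Max_ge) (auto simp: D_def)
    with Max_le have "dist x y \<le> 0" by linarith
    then show ?thesis using y by simp
  qed
  then show ?thesis by blast
qed

text \<open>If there were atoms, only finitely many could have the largest mass \<open>h\<close>.  By invariance of
  \<open>\<mu>\<close> the mass of such an atom is the average, with weights \<open>p\<^sub>i > 0\<close>, of the masses of its
  preimages, none of which exceeds \<open>h\<close>; so each preimage again has mass \<open>h\<close>, and the heaviest
  atoms form a set to which the previous lemma applies.\<close>

lemma self_similar_measure_no_atoms: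
  assumes p_pos: "\<And>i. i \<in> {1..m} \<Longrightarrow> 0 < p i" and p_sum: "(\<Sum>i=1..m. p i) = 1"
    and \<mu>: "self_similar_measure m S p \<mu>"
    and no_fixed: "\<not> (\<exists>x. \<forall>i\<in>{1..m}. S i x = x)"
  shows "{x} \<in> null_sets \<mu>"
proof (rule ccontr)
  interpret prob_space \<mu> using \<mu> by (simp add: self_similar_measure_def)
  have sets_\<mu>: "sets \<mu> = sets borel" using \<mu> by (simp add: self_similar_measure_def)
  assume "{x} \<notin> null_sets \<mu>"
  then have pos: "0 < measure \<mu> {x}"
    using sets_\<mu> by (simp add: null_sets_def emeasure_eq_measure zero_less_measure_iff)
  define B where "B = {y. measure \<mu> {x} \<le> measure \<mu> {y}}"
  have "finite B"
  proof (rule ccontr)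
    assume "infinite B"
    obtain n :: nat where n: "1 < real n * measure \<mu> {x}"
      using pos ex_less_of_nat_mult by blast
    obtain C where C: "C \<subseteq> B" "finite C" "card C = n"
      using infinite_arbitrarily_large[OF \<open>infinite B\<close>] by blast
    have "real n * measure \<mu> {x} \<le> (\<Sum>y\<in>C. measure \<mu> {y})"
      using C sum_bounded_below[of C "measure \<mu> {x}" "\<lambda>y. measure \<mu> {y}"] by (auto simp: B_def)
    also have "\<dots> = measure \<mu> C"
      using C sets_\<mu> by (intro finite_measure_eq_sum_singleton[symmetric]) auto
    also have "\<dots> \<le> 1" by simp
    finally show False using n by simp
  qed
  have xB: "x \<in> B" by (simp add: B_def)
  \<comment> \<open>Only finitely many points can be at least as heavy as \<open>x\<close>, so the supremum of all point
    masses is a maximum over \<open>B\<close>.\<close>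
  define h where "h = Max ((\<lambda>y. measure \<mu> {y}) ` B)"
  have h_B: "measure \<mu> {y} \<le> h" if "y \<in> B" for y
    unfolding h_def using that \<open>finite B\<close> by (intro Max_ge) auto
  have h_pos: "0 < h" using h_B[OF xB] pos by linarith
  have h_max: "measure \<mu> {y} \<le> h" for y
    using h_B[of y] h_B[OF xB] by (cases "y \<in> B") (auto simp: B_def)
  define A where "A = {y. measure \<mu> {y} = h}"
  have "A \<subseteq> B" using h_B[OF xB] by (auto simp: A_def B_def)
  then have "finite A" using \<open>finite B\<close> finite_subset by blast
  have "h \<in> (\<lambda>y. measure \<mu> {y}) ` B"
    unfolding h_def using \<open>finite B\<close> xB by (intro Max_in) auto
  then have "A \<noteq> {}" by (auto simp: A_def)
  have preimage: "S i -` {y} = {} \<or> (\<exists>z. y = S i z \<and> S i -` {y} = {z})" if "i \<in> {1..m}" for i y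
    using inj_S[OF that] by (auto simp: inj_def)
  have "A \<subseteq> S i ` A" if i: "i \<in> {1..m}" for i
  proof
    fix y assume "y \<in> A"
    have mass_le: "measure \<mu> (S k -` {y}) \<le> h" if "k \<in> {1..m}" for k
      using preimage[OF that, of y] h_max h_pos by auto
    have "ennreal (measure \<mu> {y}) = (\<Sum>k=1..m. ennreal (p k) * ennreal (measure \<mu> (S k -` {y})))"
      using \<mu> by (simp add: self_similar_measure_def emeasure_eq_measure[symmetric])
    also have "\<dots> = ennreal (\<Sum>k=1..m. p k * measure \<mu> (S k -` {y}))"
      using p_pos by (subst sum_ennreal[symmetric])
        (auto intro!: sum.cong simp: ennreal_mult less_imp_le)
    finally have "measure \<mu> {y} = (\<Sum>k=1..m. p k * measure \<mu> (S k -` {y}))"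
      using p_pos by (subst (asm) ennreal_inj) (auto intro!: sum_nonneg simp: less_imp_le)
    \<comment> \<open>Equality in the weighted average forces equality in every term.\<close>
    then have "(\<Sum>k=1..m. p k * (h - measure \<mu> (S k -` {y}))) = 0"
      using \<open>y \<in> A\<close> p_sum
      by (simp add: A_def right_diff_distrib sum_subtractf flip: sum_distrib_right)
    moreover have "0 \<le> p k * (h - measure \<mu> (S k -` {y}))" if "k \<in> {1..m}" for k
      using mass_le[OF that] p_pos[OF that] by simp
    ultimately have "p i * (h - measure \<mu> (S i -` {y})) = 0"
      using i by (subst (asm) sum_nonneg_eq_0_iff) auto
    then have "measure \<mu> (S i -` {y}) = h" using p_pos[OF i] by simp
    then obtain z where "y = S i z" "measure \<mu> {z} = h"
      using preimage[OF i, of y] h_pos by auto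
    then show "y \<in> S i ` A" by (auto simp: A_def)
  qed
  then show False
    using backward_invariant_finite_set_fixed[OF \<open>finite A\<close> \<open>A \<noteq> {}\<close>] no_fixed by blast
qed

end

section \<open>Weak-type bounds for trees of sets\<close>

text \<open>Every word of \<open>F\<close> has a prefix that is minimal in \<open>F\<close>, so by nesting the sets of minimal words
  have the same union.  Minimal words are pairwise incomparable, so their sets are disjoint up to
  one null set and the hypotheses on the single sets add up.\<close>

lemma tree_of_sets_weak_type:
  fixes Q :: "'i::countable list \<Rightarrow> 'b set"
  assumes Q_sets: "\<And>w. w \<in> F \<Longrightarrow> Q w \<in> sets M"
    and nested: "\<And>v w. v \<in> F \<Longrightarrow> w \<in> F \<Longrightarrow> prefix v w \<Longrightarrow> Q w \<subseteq> Q v"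
    and parallel_null: "\<And>v w. v \<in> F \<Longrightarrow> w \<in> F \<Longrightarrow> v \<parallel> w \<Longrightarrow> Q v \<inter> Q w \<in> null_sets M"
    and h: "h \<in> borel_measurable M"
    and bound: "\<And>w. w \<in> F \<Longrightarrow> c * emeasure M (Q w) \<le> (\<integral>\<^sup>+x\<in>Q w. h x \<partial>M)"
  shows "c * emeasure M (\<Union>w\<in>F. Q w) \<le> (\<integral>\<^sup>+x\<in>(\<Union>w\<in>F. Q w). h x \<partial>M)"
proof -
  define P where "P = {w \<in> F. \<forall>v\<in>F. prefix v w \<longrightarrow> v = w}"
  have "P \<subseteq> F" by (auto simp: P_def)
  have minimal_prefix: "\<exists>v\<in>P. prefix v w" if w: "w \<in> F" for w
  proof -
    obtain v where v: "v \<in> F" "prefix v w" and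
      least: "\<And>u. u \<in> F \<Longrightarrow> prefix u w \<Longrightarrow> length v \<le> length u"
      using ex_has_least_nat[of "\<lambda>v. v \<in> F \<and> prefix v w" w length] w by blast
    have "u = v" if u: "u \<in> F" "prefix u v" for u
    proof -
      obtain z where "v = u @ z" using u(2) by (rule prefixE)
      then show ?thesis
        using least[OF u(1) prefix_order.trans[OF u(2) v(2)]] by simp
    qed
    with v(1) have "v \<in> P" unfolding P_def by blast
    with v(2) show ?thesis by blast
  qed
  define U where "U = (\<Union>w\<in>P. Q w)"
  have U_eq: "(\<Union>w\<in>F. Q w) = U"
  proof
    show "(\<Union>w\<in>F. Q w) \<subseteq> U"
    proof (rule UN_least)
      fix w assume w: "w \<in> F"
      then obtain v where v: "v \<in> P" "prefix v w" using minimal_prefix by blast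
      then have "Q w \<subseteq> Q v" using nested w \<open>P \<subseteq> F\<close> by blast
      with v(1) show "Q w \<subseteq> U" by (auto simp: U_def)
    qed
  qed (use \<open>P \<subseteq> F\<close> in \<open>auto simp: U_def\<close>)
  have parallel: "v \<parallel> w" if "v \<in> P" "w \<in> P" "v \<noteq> w" for v w
    using that by (auto simp: P_def parallel_def)
  define N where "N = (\<Union>(v, w)\<in>{(v, w). v \<in> P \<and> w \<in> P \<and> v \<noteq> w}. Q v \<inter> Q w)"
  have "Q v \<inter> Q w \<in> null_sets M" if "v \<in> P" "w \<in> P" "v \<noteq> w" for v w
    using parallel_null[OF _ _ parallel[OF that]] that \<open>P \<subseteq> F\<close> by blast
  then have N: "N \<in> null_sets M"
    unfolding N_def by (intro null_sets_UN') (auto intro: countableI_type)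
  \<comment> \<open>Expressing the right-hand side through a measure makes both sides countably additive over
    the disjoint sets obtained by removing \<open>N\<close>.\<close>
  define \<nu> where "\<nu> = density M h"
  have N_\<nu>: "N \<in> null_sets \<nu>"
    unfolding \<nu>_def
    using null_sets_density_iff[OF h, of N] AE_not_in[OF N] N by auto
  have [measurable]: "Q w \<in> sets M" if "w \<in> P" for w
    using that Q_sets \<open>P \<subseteq> F\<close> by auto
  have U_sets [measurable]: "U \<in> sets M"
    unfolding U_def by (intro sets.countable_UN') auto
  have sets_\<nu> [simp]: "sets \<nu> = sets M" by (simp add: \<nu>_def)
  have emeasure_\<nu>: "emeasure \<nu> A = (\<integral>\<^sup>+x\<in>A. h x \<partial>M)" if "A \<in> sets M" for A
    unfolding \<nu>_def using h that by (rule emeasure_density)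
  define Q' where "Q' w = Q w - N" for w
  have Q'_sets [measurable]: "Q' w \<in> sets M" if "w \<in> P" for w
    unfolding Q'_def using that N by (auto intro: sets.Diff)
  have disj: "disjoint_family_on Q' P"
    unfolding disjoint_family_on_def Q'_def N_def by auto
  have UN_Q': "(\<Union>w\<in>P. Q' w) = U - N"
    by (auto simp: Q'_def U_def)
  have "c * emeasure M U = c * emeasure M (\<Union>w\<in>P. Q' w)"
    unfolding UN_Q' using emeasure_Diff_null_set[OF N U_sets] by simp
  also have "\<dots> = c * (\<integral>\<^sup>+w. emeasure M (Q' w) \<partial>count_space P)"
    by (subst emeasure_UN_countable[OF _ _ disj]) auto
  also have "\<dots> = (\<integral>\<^sup>+w. c * emeasure M (Q' w) \<partial>count_space P)"
    by (simp add: nn_integral_cmult)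
  also have "\<dots> \<le> (\<integral>\<^sup>+w. emeasure \<nu> (Q' w) \<partial>count_space P)"
  proof (rule nn_integral_mono)
    fix w assume "w \<in> space (count_space P)"
    then have w: "w \<in> P" by simp
    then have Qw: "Q w \<in> sets M" "w \<in> F" using \<open>P \<subseteq> F\<close> by auto
    have "c * emeasure M (Q' w) = c * emeasure M (Q w)"
      unfolding Q'_def using emeasure_Diff_null_set[OF N Qw(1)] by simp
    also have "\<dots> \<le> emeasure \<nu> (Q w)"
      using bound[OF Qw(2)] emeasure_\<nu>[OF Qw(1)] by simp
    also have "\<dots> = emeasure \<nu> (Q' w)"
      unfolding Q'_def using emeasure_Diff_null_set[OF N_\<nu>, of "Q w"] Qw(1) by simp
    finally show "c * emeasure M (Q' w) \<le> emeasure \<nu> (Q' w)" .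
  qed
  also have "\<dots> = emeasure \<nu> (\<Union>w\<in>P. Q' w)"
    by (subst emeasure_UN_countable[OF _ _ disj]) auto
  also have "\<dots> = emeasure \<nu> U"
    unfolding UN_Q' using emeasure_Diff_null_set[OF N_\<nu>, of U] by simp
  also have "\<dots> = (\<integral>\<^sup>+x\<in>U. h x \<partial>M)"
    by (rule emeasure_\<nu>) simp
  finally show ?thesis unfolding U_eq .
qed

text \<open>On a set with average above \<open>t\<close>, the values of \<open>g\<close> up to \<open>t / 2\<close> contribute at most \<open>t / 2\<close>
  to the average, so the part of \<open>g\<close> above \<open>t / 2\<close> still has average at least \<open>t / 2\<close>.  The claim
  is the weak-type inequality at level \<open>t / 2\<close> for that part alone.\<close>

lemma tree_maximal_function_weak_type:
  fixes Q :: "'i::countable list \<Rightarrow> 'b set" and W :: "'i list set" and M :: "'b measure"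
    and g :: "'b \<Rightarrow> real"
  defines "u \<equiv> \<lambda>x. SUP w\<in>{w \<in> W. x \<in> Q w}. (\<integral>\<^sup>+y\<in>Q w. ennreal (g y) \<partial>M) / emeasure M (Q w)"
  assumes Q_sets: "\<And>w. w \<in> W \<Longrightarrow> Q w \<in> sets M"
    and finite: "\<And>w. w \<in> W \<Longrightarrow> emeasure M (Q w) \<noteq> \<infinity>"
    and nested: "\<And>v w. v \<in> W \<Longrightarrow> w \<in> W \<Longrightarrow> prefix v w \<Longrightarrow> Q w \<subseteq> Q v"
    and parallel_null: "\<And>v w. v \<in> W \<Longrightarrow> w \<in> W \<Longrightarrow> v \<parallel> w \<Longrightarrow> Q v \<inter> Q w \<in> null_sets M"
    and g [measurable]: "g \<in> borel_measurable M"
    and t: "0 < t"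
  shows "ennreal t * emeasure M {x \<in> space M. ennreal t < u x}
    \<le> 2 * (\<integral>\<^sup>+x. (if t < 2 * g x then ennreal (g x) else 0) \<partial>M)"
proof -
  define F where "F = {w \<in> W. ennreal t < (\<integral>\<^sup>+y\<in>Q w. ennreal (g y) \<partial>M) / emeasure M (Q w)}"
  define h where "h x = (if t < 2 * g x then ennreal (g x) else 0)" for x
  have h [measurable]: "h \<in> borel_measurable M" unfolding h_def by measurable
  have superlevel: "{x \<in> space M. ennreal t < u x} = (\<Union>w\<in>F. Q w)"
    using sets.sets_into_space[OF Q_sets] by (auto simp: u_def F_def less_SUP_iff)
  have "ennreal (t / 2) * emeasure M (Q w) \<le> (\<integral>\<^sup>+x\<in>Q w. h x \<partial>M)" if "w \<in> F" for w
  proof (cases "emeasure M (Q w) = 0")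
    case False
    have w: "w \<in> W" and avg: "ennreal t < (\<integral>\<^sup>+y\<in>Q w. ennreal (g y) \<partial>M) / emeasure M (Q w)"
      using that by (auto simp: F_def)
    have [measurable]: "Q w \<in> sets M" using Q_sets w .
    have E: "emeasure M (Q w) \<noteq> top" using finite[OF w] by simp
    have "ennreal (t / 2) * emeasure M (Q w) + ennreal (t / 2) * emeasure M (Q w) = ennreal t * emeasure M (Q w)"
      using t by (simp flip: distrib_right ennreal_plus)
    also have "\<dots> \<le> (\<integral>\<^sup>+y\<in>Q w. ennreal (g y) \<partial>M) / emeasure M (Q w) * emeasure M (Q w)"
      using avg by (intro mult_right_mono) auto
    also have "\<dots> = (\<integral>\<^sup>+y\<in>Q w. ennreal (g y) \<partial>M)"
      using False E by (simp add: ennreal_divide_times ennreal_divide_self less_top)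
    also have "\<dots> \<le> (\<integral>\<^sup>+x. ennreal (t / 2) * indicator (Q w) x + h x * indicator (Q w) x \<partial>M)"
      using t by (intro nn_integral_mono) (auto simp: h_def split: split_indicator intro!: ennreal_leI)
    also have "\<dots> = ennreal (t / 2) * emeasure M (Q w) + (\<integral>\<^sup>+x\<in>Q w. h x \<partial>M)"
      by (subst nn_integral_add) (auto simp: nn_integral_cmult)
    finally show ?thesis
      using E by (simp add: ennreal_add_left_cancel_le ennreal_mult_eq_top_iff)
  qed simp
  then have "ennreal (t / 2) * emeasure M (\<Union>w\<in>F. Q w) \<le> (\<integral>\<^sup>+x\<in>(\<Union>w\<in>F. Q w). h x \<partial>M)"
    using Q_sets nested parallel_null
    by (intro tree_of_sets_weak_type[OF _ _ _ h]) (auto simp: F_def)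
  also have "\<dots> \<le> (\<integral>\<^sup>+x. h x \<partial>M)"
    by (intro nn_integral_mono) (auto split: split_indicator)
  finally have half: "ennreal (t / 2) * emeasure M (\<Union>w\<in>F. Q w) \<le> (\<integral>\<^sup>+x. h x \<partial>M)" .
  have "ennreal t = ennreal (2 * (t / 2))" by simp
  also have "\<dots> = 2 * ennreal (t / 2)" by (subst ennreal_mult') simp_all
  finally have double: "ennreal t = 2 * ennreal (t / 2)" .
  have "ennreal t * emeasure M (\<Union>w\<in>F. Q w) = 2 * (ennreal (t / 2) * emeasure M (\<Union>w\<in>F. Q w))"
    by (subst double) (rule mult.assoc)
  also have "\<dots> \<le> 2 * (\<integral>\<^sup>+x. h x \<partial>M)"
    using half by (rule mult_left_mono) simp
  finally show ?thesis
    unfolding superlevel h_def .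
qed

section \<open>From weak type to L log L\<close>

lemma nn_integral_reciprocal_layers:
  fixes a :: real
  shows "(\<integral>\<^sup>+t. (if 2 < t \<and> t < 2 * a then ennreal (2 / t) else 0) \<partial>lborel) \<le> ennreal (2 * log_plus a)"
proof (cases "1 < a")
  case True
  have "(\<integral>\<^sup>+t. (if 2 < t \<and> t < 2 * a then ennreal (2 / t) else 0) \<partial>lborel)
      \<le> (\<integral>\<^sup>+t. ennreal (2 / t) * indicator {2..2 * a} t \<partial>lborel)"
    by (intro nn_integral_mono) (auto split: split_indicator)
  also have "\<dots> = ennreal (2 * ln (2 * a) - 2 * ln 2)"
    using True
    by (intro nn_integral_FTC_Icc) (auto intro!: derivative_eq_intros)
  also have "2 * ln (2 * a) - 2 * ln 2 = 2 * log_plus a"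
    using True by (simp add: ln_mult log_plus_def)
  finally show ?thesis .
next
  case False
  then have "(\<lambda>t. if 2 < t \<and> t < 2 * a then ennreal (2 / t) else 0) = (\<lambda>_. 0)"
    by auto
  then show ?thesis by simp
qed

lemma nn_integral_layer_tail:
  fixes c :: ennreal
  shows "c \<le> 2 + (\<integral>\<^sup>+t. (if 2 < t \<and> ennreal t < c then 1 else 0) \<partial>lborel)"
proof (cases c)
  case (real a)
  have "ennreal (a - 2) = (\<integral>\<^sup>+t. indicator {2<..<a} t \<partial>lborel)" if "2 \<le> a"
    using that by simp
  also have "\<dots> \<le> (\<integral>\<^sup>+t. (if 2 < t \<and> ennreal t < c then 1 else 0) \<partial>lborel)"
    using real by (intro nn_integral_mono) (auto split: split_indicator simp: ennreal_less_iff)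
  finally have *: "ennreal (a - 2) \<le> (\<integral>\<^sup>+t. (if 2 < t \<and> ennreal t < c then 1 else 0) \<partial>lborel)"
    if "2 \<le> a" using that by simp
  show ?thesis
  proof (cases "2 \<le> a")
    case True
    have "c = 2 + ennreal (a - 2)"
      using True real by (metis diff_add_cancel diff_ge_0_iff_ge ennreal_numeral ennreal_plus add.commute zero_le_numeral)
    then show ?thesis using *[OF True] by (simp add: add_left_mono)
  next
    case False
    then have "c \<le> 2" using real by (metis ennreal_leI ennreal_numeral linear)
    then show ?thesis by (simp add: add_increasing2)
  qed
next
  case top
  have "(\<integral>\<^sup>+t. (if 2 < t \<and> ennreal t < c then 1 else 0) \<partial>lborel) = (\<integral>\<^sup>+t. indicator {2<..} t \<partial>(lborel::real measure))"
    using top by (intro nn_integral_cong) (auto split: split_indicator)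
  also have "\<dots> = emeasure lborel {(2::real)<..}" by simp
  also have "\<dots> = top"
  proof (rule ccontr)
    assume "emeasure lborel {(2::real)<..} \<noteq> top"
    then obtain n where n: "emeasure lborel {(2::real)<..} < of_nat n"
      using ennreal_Ex_less_of_nat by (auto simp: less_top)
    have "of_nat n = emeasure lborel {(2::real)<..<2 + real n}"
      by (simp add: ennreal_of_nat_eq_real_of_nat)
    also have "\<dots> \<le> emeasure lborel {(2::real)<..}"
      by (intro emeasure_mono) auto
    finally show False using n by simp
  qed
  finally show ?thesis by simp
qed

text \<open>Integration of the weak-type estimate over the levels \<open>t > 2\<close>.  The levels below \<open>2\<close> cost
  \<open>2\<close> times the measure of the support.  Starting at \<open>2\<close> is what makes the integral of \<open>2 / t\<close> over
  \<open>2 < t < 2 g\<close> equal to \<open>2 log\<^sup>+ g\<close> without an additional constant.\<close>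

lemma nn_integral_LlogL_bound:
  fixes u :: "'b \<Rightarrow> ennreal" and g :: "'b \<Rightarrow> real"
  assumes "sigma_finite_measure M"
    and u [measurable]: "u \<in> borel_measurable M"
    and g [measurable]: "g \<in> borel_measurable M"
    and K [measurable]: "K \<in> sets M"
    and support: "\<And>x. x \<notin> K \<Longrightarrow> u x = 0"
    and weak: "\<And>t. 0 < t \<Longrightarrow> ennreal t * emeasure M {x \<in> space M. ennreal t < u x}
      \<le> 2 * (\<integral>\<^sup>+x. (if t < 2 * g x then ennreal (g x) else 0) \<partial>M)"
  shows "(\<integral>\<^sup>+x. u x \<partial>M) \<le> 2 * emeasure M K + 2 * (\<integral>\<^sup>+x. ennreal (g x * log_plus (g x)) \<partial>M)"
proof -
  interpret sigma_finite_measure M by fact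
  interpret pair_sigma_finite M "lborel :: real measure" ..
  \<comment> \<open>\<open>F\<close> is the layer decomposition of \<open>u\<close> above level \<open>2\<close>, and \<open>G\<close> is what the weak-type estimate
    bounds it by, after integration over \<open>x\<close> at each level \<open>t\<close>.\<close>
  define F :: "'b \<Rightarrow> real \<Rightarrow> ennreal" where "F x t = (if 2 < t \<and> ennreal t < u x then 1 else 0)" for x t
  define G :: "'b \<Rightarrow> real \<Rightarrow> ennreal" where
    "G x t = (if 2 < t \<and> t < 2 * g x then ennreal (2 / t) else 0) * ennreal (g x)" for x t
  have F_meas [measurable]: "case_prod F \<in> borel_measurable (M \<Otimes>\<^sub>M lborel)"
    unfolding F_def by measurable
  have G_meas [measurable]: "case_prod G \<in> borel_measurable (M \<Otimes>\<^sub>M lborel)"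
    unfolding G_def by measurable
  have slice: "(\<integral>\<^sup>+x. F x t \<partial>M) \<le> (\<integral>\<^sup>+x. G x t \<partial>M)" for t
  proof (cases "2 < t")
    case True
    have "(\<integral>\<^sup>+x. F x t \<partial>M) = (\<integral>\<^sup>+x. indicator {x \<in> space M. ennreal t < u x} x \<partial>M)"
      using True by (intro nn_integral_cong) (auto simp: F_def split: split_indicator)
    also have "\<dots> = emeasure M {x \<in> space M. ennreal t < u x}"
      by (subst nn_integral_indicator) auto
    also have "\<dots> = ennreal (1 / t) * (ennreal t * emeasure M {x \<in> space M. ennreal t < u x})"
      using True by (simp add: mult.assoc[symmetric] flip: ennreal_mult)
    also have "\<dots> \<le> ennreal (1 / t) * (2 * (\<integral>\<^sup>+x. (if t < 2 * g x then ennreal (g x) else 0) \<partial>M))"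
      using True by (intro mult_left_mono weak) auto
    also have "\<dots> = ennreal (2 / t) * (\<integral>\<^sup>+x. (if t < 2 * g x then ennreal (g x) else 0) \<partial>M)"
    proof -
      have "ennreal (2 / t) = ennreal (1 / t) * 2"
        using True ennreal_mult''[of 2 "1 / t"] by simp
      then show ?thesis by (simp add: mult.assoc)
    qed
    also have "\<dots> = (\<integral>\<^sup>+x. ennreal (2 / t) * (if t < 2 * g x then ennreal (g x) else 0) \<partial>M)"
      by (subst nn_integral_cmult) auto
    also have "\<dots> = (\<integral>\<^sup>+x. G x t \<partial>M)"
      using True by (intro nn_integral_cong) (auto simp: G_def)
    finally show ?thesis .
  qed (simp add: F_def)
  have "(\<integral>\<^sup>+x. u x \<partial>M) \<le> (\<integral>\<^sup>+x. 2 * indicator K x + (\<integral>\<^sup>+t. F x t \<partial>lborel) \<partial>M)"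
  proof (rule nn_integral_mono)
    fix x
    show "u x \<le> 2 * indicator K x + (\<integral>\<^sup>+t. F x t \<partial>lborel)"
      using nn_integral_layer_tail[of "u x"] support[of x]
      by (cases "x \<in> K") (auto simp: F_def)
  qed
  also have "\<dots> = 2 * emeasure M K + (\<integral>\<^sup>+x. (\<integral>\<^sup>+t. F x t \<partial>lborel) \<partial>M)"
    by (subst nn_integral_add) (auto simp: nn_integral_cmult)
  also have "(\<integral>\<^sup>+x. (\<integral>\<^sup>+t. F x t \<partial>lborel) \<partial>M) = (\<integral>\<^sup>+t. (\<integral>\<^sup>+x. F x t \<partial>M) \<partial>lborel)"
    by (rule Fubini'[symmetric]) simp
  also have "\<dots> \<le> (\<integral>\<^sup>+t. (\<integral>\<^sup>+x. G x t \<partial>M) \<partial>lborel)"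
    by (intro nn_integral_mono slice)
  also have "\<dots> = (\<integral>\<^sup>+x. (\<integral>\<^sup>+t. G x t \<partial>lborel) \<partial>M)"
    by (rule Fubini') simp
  also have "\<dots> \<le> (\<integral>\<^sup>+x. 2 * ennreal (g x * log_plus (g x)) \<partial>M)"
  proof (rule nn_integral_mono)
    fix x
    have "(\<integral>\<^sup>+t. G x t \<partial>lborel)
        = (\<integral>\<^sup>+t. (if 2 < t \<and> t < 2 * g x then ennreal (2 / t) else 0) \<partial>lborel) * ennreal (g x)"
      unfolding G_def by (subst nn_integral_multc) auto
    also have "\<dots> \<le> ennreal (2 * log_plus (g x)) * ennreal (g x)"
      by (intro mult_right_mono nn_integral_reciprocal_layers) auto
    also have "\<dots> = 2 * ennreal (g x * log_plus (g x))"
    proof (cases "g x \<ge> 0")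
      case True
      have "0 \<le> log_plus (g x)" by (simp add: log_plus_def)
      with True show ?thesis
        by (simp add: ennreal_mult mult_ac)
    next
      case False
      then have "g x * log_plus (g x) \<le> 0" by (simp add: log_plus_def mult_nonpos_nonneg)
      with False show ?thesis by (simp add: ennreal_neg)
    qed
    finally show "(\<integral>\<^sup>+t. G x t \<partial>lborel) \<le> 2 * ennreal (g x * log_plus (g x))" .
  qed
  also have "\<dots> = 2 * (\<integral>\<^sup>+x. ennreal (g x * log_plus (g x)) \<partial>M)"
    unfolding log_plus_def by (subst nn_integral_cmult) auto
  finally show ?thesis by (simp add: add_left_mono)
qed

theorem proposition1p6:
  fixes m :: nat
    and r :: "nat \<Rightarrow> real"
    and R :: "nat \<Rightarrow> 'a::euclidean_space \<Rightarrow> 'a"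
    and b :: "nat \<Rightarrow> 'a"
    and S :: "nat \<Rightarrow> 'a \<Rightarrow> 'a"
    and K :: "'a set"
    and p :: "nat \<Rightarrow> real"
    and \<mu> :: "'a measure"
    and f :: "'a \<Rightarrow> real"
  assumes ratio: "\<And>i. i \<in> {1..m} \<Longrightarrow> 0 < r i \<and> r i < 1"
    and orth: "\<And>i. i \<in> {1..m} \<Longrightarrow> orthogonal_transformation (R i)"
    and S: "\<And>i x. i \<in> {1..m} \<Longrightarrow> S i x = r i *\<^sub>R R i x + b i"
    and no_common_fixed_point: "\<not> (\<exists>x. \<forall>i\<in>{1..m}. S i x = x)"
    and K: "self_similar_set m S K"
    and p_pos: "\<And>i. i \<in> {1..m} \<Longrightarrow> 0 < p i"
    and p_sum: "(\<Sum>i=1..m. p i) = 1"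
    and \<mu>: "self_similar_measure m S p \<mu>"
    and pcf: "post_critically_finite m S K"
    and f_measurable: "f \<in> borel_measurable (restrict_space (completion \<mu>) K)"
    and f_LlogL: "set_integrable (completion \<mu>) K (\<lambda>x. \<bar>f x\<bar> * log_plus \<bar>f x\<bar>)"
  shows "(\<integral>\<^sup>+x\<in>K. basic_cube_maximal m S K \<mu> f x \<partial>completion \<mu>)
     \<le> ennreal (2 * measure \<mu> K + 8 * (LINT x:K|completion \<mu>. \<bar>f x\<bar> * log_plus \<bar>f x\<bar>))"
proof -
  interpret similar: self_similar_system m r S K
  proof
    fix i x y assume i: "i \<in> {1..m}"
    have "S i x - S i y = r i *\<^sub>R R i (x - y)"
      using orth[OF i] by (simp add: S[OF i] orthogonal_transformation_linear linear_diff scaleR_diff_right)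
    then have "dist (S i x) (S i y) = \<bar>r i\<bar> * norm (R i (x - y))"
      by (simp add: dist_norm)
    then show "dist (S i x) (S i y) = r i * dist x y"
      using orth[OF i] ratio[OF i] by (simp add: orthogonal_transformation_norm dist_norm)
  qed (use ratio K in auto)
  interpret prob_space \<mu> using \<mu> by (simp add: self_similar_measure_def)
  have sets_\<mu>: "sets \<mu> = sets borel" using \<mu> by (simp add: self_similar_measure_def)
  define M where "M = completion \<mu>"
  have M_sets: "A \<in> sets M" and M_emeasure: "emeasure M A = emeasure \<mu> A" if "A \<in> sets borel" for A
    using that sets_\<mu> by (auto simp: M_def)
  have space_M: "space M = UNIV"
    using sets_eq_imp_space_eq[OF sets_\<mu>] by (simp add: M_def)
  have K_borel: "K \<in> sets borel"
    using K by (auto simp: self_similar_set_def intro: borel_compact)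
  note K_sets [measurable] = M_sets[OF K_borel]
  define W where "W = (\<Union>n\<in>{1..}. words m n)"
  define Q where "Q = basic_cube S K"
  have letters: "set w \<subseteq> {1..m}" if "w \<in> W" for w
    using that by (auto simp: W_def words_def)
  have Q_borel: "Q w \<in> sets borel" if "w \<in> W" for w
    unfolding Q_def using similar.compact_basic_cube[OF letters[OF that]] by (rule borel_compact)
  have Q_sets [measurable]: "Q w \<in> sets M" if "w \<in> W" for w
    using Q_borel[OF that] by (rule M_sets)
  have Q_subset: "Q w \<subseteq> K" if "w \<in> W" for w
    unfolding Q_def by (rule similar.basic_cube_subset[OF letters[OF that]])
  have finite_null: "A \<in> null_sets M" if "finite A" for A
  proof -
    have "(\<Union>x\<in>A. {x}) \<in> null_sets \<mu>"
      using similar.self_similar_measure_no_atoms[OF p_pos p_sum \<mu> no_common_fixed_point] that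
      by (intro null_sets_UN' countable_finite)
    then show ?thesis by (simp add: M_def null_sets_completionI)
  qed

  \<comment> \<open>Nothing is assumed of \<open>f\<close> outside \<open>K\<close>, so it is replaced by zero there.\<close>
  define g where "g x = indicator K x * \<bar>f x\<bar>" for x
  have "(\<lambda>x. indicator K x *\<^sub>R f x) \<in> borel_measurable M"
    using f_measurable K_sets
    by (subst (asm) borel_measurable_restrict_space_iff) (auto simp: M_def)
  then have "(\<lambda>x. \<bar>indicator K x *\<^sub>R f x\<bar>) \<in> borel_measurable M"
    by measurable
  moreover have "(\<lambda>x. \<bar>indicator K x *\<^sub>R f x\<bar>) = g"
    by (rule ext) (simp add: g_def abs_mult)
  ultimately have g [measurable]: "g \<in> borel_measurable M" by simp

  define avg where "avg w = (\<integral>\<^sup>+y\<in>Q w. ennreal (g y) \<partial>M) / emeasure M (Q w)" for w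
  define u where "u x = (SUP w\<in>{w \<in> W. x \<in> Q w}. avg w)" for x
  have maximal_eq: "basic_cube_maximal m S K \<mu> f x = u x" for x
  proof -
    have "(\<integral>\<^sup>+y\<in>Q w. ennreal \<bar>f y\<bar> \<partial>M) / emeasure \<mu> (Q w) = avg w" if "w \<in> W" for w
    proof -
      have "(\<integral>\<^sup>+y\<in>Q w. ennreal \<bar>f y\<bar> \<partial>M) = (\<integral>\<^sup>+y\<in>Q w. ennreal (g y) \<partial>M)"
        using Q_subset[OF that] by (intro nn_integral_cong) (auto simp: g_def split: split_indicator)
      then show ?thesis
        unfolding avg_def M_emeasure[OF Q_borel[OF that]] by simp
    qed
    then show ?thesis
      unfolding u_def basic_cube_maximal_def W_def[symmetric] Q_def[symmetric] M_def[symmetric]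
      by (intro SUP_cong) auto
  qed
  have u_outside: "u x = 0" if "x \<notin> K" for x
  proof -
    have "{w \<in> W. x \<in> Q w} = {}" using that Q_subset by blast
    then have "u x = (SUP w\<in>{}. avg w)" by (simp only: u_def)
    then show ?thesis by (simp add: bot_ennreal)
  qed
  \<comment> \<open>A supremum over one countable index set, independent of \<open>x\<close>, makes measurability visible.\<close>
  have u_indicator: "u x = (SUP w\<in>W. avg w * indicator (Q w) x)" for x
    unfolding u_def
    by (intro antisym SUP_least) (auto intro: SUP_upper2 split: split_indicator)
  have u [measurable]: "u \<in> borel_measurable M"
    unfolding u_indicator[abs_def] by (intro borel_measurable_SUP) auto

  have weak: "ennreal t * emeasure M {x \<in> space M. ennreal t < u x}
      \<le> 2 * (\<integral>\<^sup>+x. (if t < 2 * g x then ennreal (g x) else 0) \<partial>M)" if "0 < t" for t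
    unfolding u_def avg_def
  proof (rule tree_maximal_function_weak_type)
    show "emeasure M (Q w) \<noteq> \<infinity>" if "w \<in> W" for w
      using M_emeasure[OF Q_borel[OF that]] by simp
    show "Q w \<subseteq> Q v" if "w \<in> W" "prefix v w" for v w
      unfolding Q_def by (rule similar.basic_cube_prefix[OF that(2) letters[OF that(1)]])
    show "Q v \<inter> Q w \<in> null_sets M" if "v \<in> W" "w \<in> W" "v \<parallel> w" for v w
      unfolding Q_def
      by (intro finite_null similar.finite_parallel_cubes_Int pcf letters that)
  qed (use Q_sets g that in auto)

  have "prob_space M" unfolding M_def by (rule prob_space_completion)
  then have "sigma_finite_measure M"
    by (simp add: prob_space_imp_sigma_finite)
  then have bound: "(\<integral>\<^sup>+x. u x \<partial>M) \<le> 2 * emeasure M K + 2 * (\<integral>\<^sup>+x. ennreal (g x * log_plus (g x)) \<partial>M)"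
    by (rule nn_integral_LlogL_bound) (use u_outside weak in auto)

  define L where "L = (LINT x:K|M. \<bar>f x\<bar> * log_plus \<bar>f x\<bar>)"
  have g_log: "g x * log_plus (g x) = indicator K x *\<^sub>R (\<bar>f x\<bar> * log_plus \<bar>f x\<bar>)" for x
    by (simp add: g_def split: split_indicator)
  have log_nonneg: "0 \<le> g x * log_plus (g x)" for x
    by (simp add: g_def log_plus_def)
  have "integrable M (\<lambda>x. g x * log_plus (g x))"
    using f_LlogL unfolding g_log set_integrable_def M_def .
  then have L: "(\<integral>\<^sup>+x. ennreal (g x * log_plus (g x)) \<partial>M) = ennreal L"
    unfolding L_def set_lebesgue_integral_def g_log[symmetric]
    by (intro nn_integral_eq_integral) (use log_nonneg in auto)
  have L_nonneg: "0 \<le> L"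
    unfolding L_def set_lebesgue_integral_def g_log[symmetric]
    by (intro integral_nonneg_AE) (use log_nonneg in auto)

  have "(\<integral>\<^sup>+x\<in>K. basic_cube_maximal m S K \<mu> f x \<partial>M) \<le> (\<integral>\<^sup>+x. u x \<partial>M)"
    unfolding maximal_eq by (intro nn_integral_mono) (auto split: split_indicator)
  also note bound
  also have "2 * emeasure M K + 2 * (\<integral>\<^sup>+x. ennreal (g x * log_plus (g x)) \<partial>M)
      = ennreal (2 * measure \<mu> K + 2 * L)"
    using L_nonneg unfolding L M_emeasure[OF K_borel]
    by (simp add: emeasure_eq_measure ennreal_mult)
  also have "\<dots> \<le> ennreal (2 * measure \<mu> K + 8 * L)"
    using L_nonneg by (intro ennreal_leI) simp
  finally show ?thesis unfolding L_def M_def .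
qed

end
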